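(* Let $p$ be a prime and $q\in\mathbb{C}_p$ with $|1-q|_p<1$. For $s\in\mathbb{N}$ and $m_1,\ldots,m_s,n_1,\ldots,n_s,k\in\mathbb{Z}_+$ with $m_1n_1+\cdots+m_sn_s>(m_1+\cdots+m_s)k+1$, $$\sum_{l=0}^{k\sum_{i=1}^s m_i}\binom{k\sum_{i=1}^s m_i}{l}(-1)^{k\sum_{i=1}^s m_i-l}\Big\{\Big(\sum_{i=1}^s m_in_i-l+1\Big)-q+q^2\beta_{n_1m_1+\cdots+n_sm_s-l,\frac{1}{q}}\Big\}$$ $$=\sum_{l=0}^{\sum_{i=1}^s n_im_i-k\sum_{i=1}^s m_i}\binom{\sum_{i=1}^s n_im_i-k\sum_{i=1}^s m_i}{l}(-1)^l\beta_{(m_1+\cdots+m_s)k+l,q}.$$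
   Context: $\mathbb{Z}_+=\mathbb{N}\cup\{0\}$. The Carlitz $q$-Bernoulli numbers are defined by $\beta_{0,q}=1$ and $q(q\beta+1)^k-\beta_{k,q}=1$ if $k=1$, $0$ if $k>1$, with the umbral convention of replacing $\beta^i$ by $\beta_{i,q}$ after binomial expansion; $\beta_{k,1/q}$ denotes the same numbers with $q$ replaced by $q^{-1}$. *)

theory Defs
  imports "HOL-Analysis.Analysis" "HOL-Computational_Algebra.Computational_Algebra"
begin

locale nonarch_valued_field =
  fixes absv :: "'a::field_char_0 \<Rightarrow> real"
  assumes absv_nonneg: "0 \<le> absv x"
    and absv_eq_0_iff: "absv x = 0 \<longleftrightarrow> x = 0"
    and absv_mult: "absv (x * y) = absv x * absv y"
    and absv_ultrametric: "absv (x + y) \<le> max (absv x) (absv y)"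
begin

lemma absv_1: "absv 1 = 1"
  using absv_mult[of 1 1] absv_eq_0_iff[of 1] by simp

lemma absv_minus: "absv (- x) = absv x"
proof -
  have "(absv (- 1))\<^sup>2 = 1"
    using absv_mult[of "- 1" "- 1"] absv_1 by (simp add: power2_eq_square)
  hence "absv (- 1) = 1"
    using absv_nonneg[of "- 1"] by (simp add: power2_eq_1_iff)
  thus ?thesis
    using absv_mult[of "- 1" x] by simp
qed

sublocale Metric_space UNIV "\<lambda>x y. absv (x - y)"
proof
  fix x y z :: 'a
  show "0 \<le> absv (x - y)" by (rule absv_nonneg)
  show "absv (x - y) = absv (y - x)" using absv_minus[of "x - y"] by simp
  show "absv (x - y) = 0 \<longleftrightarrow> x = y" by (simp add: absv_eq_0_iff)
  have "absv (x - z) \<le> max (absv (x - y)) (absv (y - z))"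
    using absv_ultrametric[of "x - y" "y - z"] by simp
  thus "absv (x - z) \<le> absv (x - y) + absv (y - z)"
    using absv_nonneg[of "x - y"] absv_nonneg[of "y - z"] by linarith
qed

definition rat_completion :: "'a set" where
  "rat_completion = mtopology closure_of (range of_rat)"

definition rat_completion_alg :: "'a set" where
  "rat_completion_alg =
     {x. \<exists>f. f \<noteq> 0 \<and> set (coeffs f) \<subseteq> rat_completion \<and> poly f x = 0}"

end

text \<open>
  The field of \<open>p\<close>-adic complex numbers, determined up to isometric isomorphism as the completion
  of an algebraic closure of the \<open>p\<close>-adic numbers.  An ultrametric absolute value with
  \<open>\<bar>p\<bar> = 1/p\<close> restricts to the \<open>p\<close>-adic absolute value on the rationals, so in a complete field
  \<^const>\<open>nonarch_valued_field.rat_completion\<close> is the field of \<open>p\<close>-adic numbers and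
  \<^const>\<open>nonarch_valued_field.rat_completion_alg\<close> is its relative algebraic closure.
\<close>

locale padic_complex_field = nonarch_valued_field absv
  for p :: nat and absv :: "'a::field_char_0 \<Rightarrow> real" +
  assumes prime_p: "prime p"
    and absv_p: "absv (of_nat p) = 1 / real p"
    and complete: mcomplete
    and alg_closed: "\<And>f. \<lbrakk>set (coeffs f) \<subseteq> rat_completion_alg; degree f > 0\<rbrakk>
                       \<Longrightarrow> \<exists>x\<in>rat_completion_alg. poly f x = 0"
    and alg_dense: "mtopology closure_of rat_completion_alg = UNIV"

text \<open>
  The sum is the umbral expansion of \<open>(q\<beta> + 1)^k\<close>.  The coefficient of \<open>b k\<close> in the \<open>k\<close>-th
  equation is \<open>q^(k+1) - 1\<close>; the defining relations are therefore kept as a predicate instead of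
  being solved for \<open>b k\<close> by a division, which would be meaningless when \<open>q\<close> is a root of unity.
  At \<open>q = 1\<close> they still determine \<open>b\<close>, namely as the classical Bernoulli numbers.
\<close>

definition is_carlitz_bernoulli :: "'a::field_char_0 \<Rightarrow> (nat \<Rightarrow> 'a) \<Rightarrow> bool" where
  "is_carlitz_bernoulli q b \<longleftrightarrow>
     b 0 = 1 \<and>
     (\<forall>k\<ge>1. q * (\<Sum>i\<le>k. of_nat (k choose i) * (q ^ i * b i)) - b k = (if k = 1 then 1 else 0))"

lemma is_carlitz_bernoulli_step:
  fixes b :: "nat \<Rightarrow> 'a::field_char_0"
  shows "q * (\<Sum>i\<le>k. of_nat (k choose i) * (q ^ i * b i)) - b k =
         q * (\<Sum>i<k. of_nat (k choose i) * (q ^ i * b i)) + (q ^ (k + 1) - 1) * b k"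
  by (simp add: lessThan_Suc_atMost[symmetric] algebra_simps)

lemma is_carlitz_bernoulli_unique:
  assumes "\<And>k. k \<ge> 1 \<Longrightarrow> q ^ (k + 1) \<noteq> 1"
    and b: "is_carlitz_bernoulli q b" and c: "is_carlitz_bernoulli q c"
  shows "b = c"
proof
  fix k show "b k = c k"
  proof (induction k rule: less_induct)
    case (less k)
    show ?case
    proof (cases "k = 0")
      case True thus ?thesis using b c by (simp add: is_carlitz_bernoulli_def)
    next
      case False
      have "(\<Sum>i<k. of_nat (k choose i) * (q ^ i * b i)) =
            (\<Sum>i<k. of_nat (k choose i) * (q ^ i * c i))"
        using less by (intro sum.cong) auto
      moreover have "q * (\<Sum>i\<le>k. of_nat (k choose i) * (q ^ i * b i)) - b k =
            q * (\<Sum>i\<le>k. of_nat (k choose i) * (q ^ i * c i)) - c k"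
        using b c False by (simp add: is_carlitz_bernoulli_def)
      ultimately have "(q ^ (k + 1) - 1) * b k = (q ^ (k + 1) - 1) * c k"
        unfolding is_carlitz_bernoulli_step by simp
      thus ?thesis using assms(1)[of k] False by simp
    qed
  qed
qed

lemma is_carlitz_bernoulli_exists:
  fixes q :: "'a::field_char_0"
  assumes q: "\<And>k. k \<ge> 1 \<Longrightarrow> q ^ (k + 1) \<noteq> 1"
  shows "\<exists>b. is_carlitz_bernoulli q b"
proof -
  define F where "F = (\<lambda>(b :: nat \<Rightarrow> 'a) k. if k = 0 then 1 else
     ((if k = 1 then 1 else 0) - q * (\<Sum>i<k. of_nat (k choose i) * (q ^ i * b i))) / (q ^ (k + 1) - 1))"
  define b where "b = wfrec less_than F"
  have b: "b k = F b k" for k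
  proof -
    have "b k = F (cut b less_than k) k"
      unfolding b_def by (rule wfrec) simp
    also have "\<dots> = F b k"
      by (simp add: F_def cut_apply)
    finally show ?thesis .
  qed
  have "q * (\<Sum>i\<le>k. of_nat (k choose i) * (q ^ i * b i)) - b k = (if k = 1 then 1 else 0)"
    if k: "k \<ge> 1" for k
  proof -
    have "(q ^ (k + 1) - 1) * b k =
          (if k = 1 then 1 else 0) - q * (\<Sum>i<k. of_nat (k choose i) * (q ^ i * b i))"
      unfolding b[of k] using q[OF k] k by (simp add: F_def)
    thus ?thesis unfolding is_carlitz_bernoulli_step by simp
  qed
  moreover have "b 0 = 1" using b[of 0] by (simp add: F_def)
  ultimately show ?thesis unfolding is_carlitz_bernoulli_def by blast
qed

end

theory Submission
  imports Defs
begin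

text \<open>
  Read the Carlitz numbers as the moments of a linear functional \<open>L\<close> on polynomials,
  \<open>L(X^i) = \<beta>\<^sub>i\<close>.  The defining relations say
  \<open>q L(f(qX + 1)) - L(f) = f'(0) + (q - 1) f(0)\<close> for all \<open>f\<close>.  Taking \<open>f = (1 - (1 - q)X)^j\<close>
  shows that \<open>q\<close> is \<open>1\<close> or not a root of unity, so that the relations have at most one
  solution.  The moments \<open>L((-q(qX + 1))^n)\<close> solve the relations for \<open>1/q\<close>, hence are
  \<open>\<beta>\<^bsub>n,1/q\<^esub>\<close>; then \<open>f = (1 - X)^n\<close> gives
  \<open>L((1 - X)^n) = n + 1 - q + q\<^sup>2 \<beta>\<^bsub>n,1/q\<^esub>\<close> for \<open>n > 1\<close>.  The theorem is the
  expansion of \<open>L(X^K (1 - X)^(N - K))\<close> in powers of \<open>X\<close> and in powers of \<open>1 - X\<close>.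
\<close>

definition umbral :: "(nat \<Rightarrow> 'a::comm_ring_1) \<Rightarrow> 'a poly \<Rightarrow> 'a" where
  "umbral b p = (\<Sum>i\<le>degree p. coeff p i * b i)"

lemma umbral_eq_sum:
  assumes "degree p \<le> N"
  shows "umbral b p = (\<Sum>i\<le>N. coeff p i * b i)"
  unfolding umbral_def using assms
  by (intro sum.mono_neutral_left) (auto simp: coeff_eq_0)

lemma umbral_0 [simp]: "umbral b 0 = 0"
  by (simp add: umbral_def)

lemma umbral_add: "umbral b (p + r) = umbral b p + umbral b r"
proof -
  define N where "N = max (degree p) (degree r)"
  have "umbral b (p + r) = (\<Sum>i\<le>N. coeff (p + r) i * b i)"
    by (rule umbral_eq_sum) (simp add: N_def degree_add_le_max)
  moreover have "umbral b p = (\<Sum>i\<le>N. coeff p i * b i)" "umbral b r = (\<Sum>i\<le>N. coeff r i * b i)"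
    by (rule umbral_eq_sum, simp add: N_def)+
  ultimately show ?thesis by (simp add: sum.distrib algebra_simps)
qed

lemma umbral_smult: "umbral b (smult c p) = c * umbral b p"
  using umbral_eq_sum[of "smult c p" "degree p" b]
  by (simp add: degree_smult_le umbral_def sum_distrib_left mult.assoc)

lemma umbral_sum: "umbral b (\<Sum>i\<in>A. f i) = (\<Sum>i\<in>A. umbral b (f i))"
  by (induction A rule: infinite_finite_induct) (simp_all add: umbral_add)

lemma umbral_X_power: "umbral b ([:0, 1:] ^ n) = b n"
proof -
  have "[:0, 1:] ^ n = (monom 1 n :: 'a poly)" by (simp add: monom_altdef)
  thus ?thesis by (simp add: umbral_def degree_monom_eq if_distrib[of "\<lambda>x. x * _"] cong: if_cong)
qed

lemma pcompose_eq_sum: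
  "pcompose p r = (\<Sum>i\<le>degree p. smult (coeff p i) (r ^ i))"
  by (simp add: pcompose_altdef poly_altdef coeff_map_poly degree_map_poly)

text \<open>Sending \<open>p\<close> to the value of the functional at \<open>pcompose p r\<close>
  is again linear, hence is determined by its moments, the values at \<open>r ^ n\<close>. This lets
  a change of variable turn one moment sequence into another.\<close>

lemma umbral_pcompose:
  assumes "\<And>n. c n = umbral b (r ^ n)"
  shows "umbral b (pcompose p r) = umbral c p"
  by (simp add: pcompose_eq_sum umbral_sum umbral_smult assms umbral_def[of c])

lemma linear_power_eq_sum:
  "[:a, c:] ^ n = (\<Sum>i\<le>n. smult (of_nat (n choose i) * c ^ i * a ^ (n - i)) ([:0, 1:] ^ i))"
  for a :: "'a::comm_ring_1"
proof -
  have "degree ([:a, c:] ^ n) \<le> n"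
    using degree_power_le[of "[:a, c:]" n] by (cases "c = 0") auto
  hence "[:a, c:] ^ n = (\<Sum>i\<le>n. monom (coeff ([:a, c:] ^ n) i) i)"
    by (rule poly_as_sum_of_monoms'[symmetric])
  thus ?thesis by (simp add: coeff_linear_poly_power monom_altdef)
qed

lemma umbral_linear_power:
  "umbral b ([:a, c:] ^ n) = (\<Sum>i\<le>n. of_nat (n choose i) * c ^ i * a ^ (n - i) * b i)"
  by (simp only: linear_power_eq_sum[of a c] umbral_sum umbral_smult umbral_X_power)

lemma is_carlitz_bernoulli_iff_umbral:
  "is_carlitz_bernoulli q b \<longleftrightarrow>
     b 0 = 1 \<and> (\<forall>k\<ge>1. q * umbral b ([:1, q:] ^ k) - b k = (if k = 1 then 1 else 0))"
  by (simp add: is_carlitz_bernoulli_def umbral_linear_power mult.assoc)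

text \<open>Both sides are linear in \<open>f\<close>, so monomials suffice, and there the claim is
  the defining relation.\<close>

lemma carlitz_functional_equation:
  assumes "is_carlitz_bernoulli q b"
  shows "q * umbral b (pcompose f [:1, q:]) - umbral b f = coeff f 1 + (q - 1) * coeff f 0"
proof -
  \<comment> \<open>The relations start at index 1; at index 0 the value \<open>q - 1\<close> comes
    from \<open>b 0 = 1\<close>.\<close>
  have step: "q * umbral b ([:1, q:] ^ i) - b i = (if i = 1 then 1 else 0) + (q - 1) * (if i = 0 then 1 else 0)"
    for i
    using assms by (cases "i = 0") (auto simp: is_carlitz_bernoulli_iff_umbral umbral_def)
  have "q * umbral b (pcompose f [:1, q:]) - umbral b f =
        (\<Sum>i\<le>degree f. coeff f i * (q * umbral b ([:1, q:] ^ i) - b i))"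
    by (simp add: pcompose_eq_sum umbral_sum umbral_smult umbral_def[of b f]
        sum_subtractf sum_distrib_left algebra_simps)
  also have "\<dots> = (\<Sum>i\<le>degree f. if i = 1 then coeff f i else 0) +
                  (\<Sum>i\<le>degree f. if i = 0 then (q - 1) * coeff f i else 0)"
    unfolding step sum.distrib[symmetric] by (intro sum.cong) auto
  also have "\<dots> = coeff f 1 + (q - 1) * coeff f 0"
    by (auto simp: coeff_eq_0)
  finally show ?thesis .
qed

lemma coeff_linear_power_1: "coeff ([:a, c:] ^ n) 1 = of_nat n * c * a ^ (n - 1)"
  for a :: "'a::comm_ring_1"
  by (cases n) (simp_all add: coeff_linear_poly_power del: power_Suc)

lemma pcompose_power: "pcompose (p ^ n) r = pcompose p r ^ n"
  for p :: "'a::comm_ring_1 poly"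
  by (induction n) (simp_all add: pcompose_mult pcompose_1)

text \<open>The substitution X -> qX + 1 multiplies 1 + (q - 1)X by q. For its j-th power the left
  side of the functional equation is (q^(j+1) - 1) L(f) = 0, whereas the right side is (j + 1)(q -
  1), nonzero in characteristic 0.\<close>

lemma carlitz_no_root_of_unity:
  assumes b: "is_carlitz_bernoulli q b" and "q \<noteq> 1"
  shows "q ^ (j + 1) \<noteq> 1"
proof
  assume q: "q ^ (j + 1) = 1"
  define f where "f = [:1, q - 1:] ^ j"
  have "pcompose [:1, q - 1:] [:1, q:] = smult q [:1, q - 1:]"
    by (simp add: pcompose_pCons algebra_simps)
  hence "pcompose f [:1, q:] = smult (q ^ j) f"
    by (simp only: f_def pcompose_power smult_power)
  moreover have "q * q ^ j = 1" using q by simp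
  ultimately have "0 = of_nat j * (q - 1) + (q - 1)"
    using carlitz_functional_equation[OF b, of f]
    by (simp add: umbral_smult f_def coeff_0_power coeff_linear_power_1
        flip: mult.assoc del: One_nat_def)
  hence "of_nat (Suc j) * (q - 1) = 0" by (simp only: of_nat_Suc distrib_right mult_1_left add.commute)
  thus False using \<open>q \<noteq> 1\<close> by (simp del: of_nat_Suc)
qed

text \<open>At q = 1 the term \<open>b k\<close> cancels from relation k. It is recovered from
  relation k + 1, where its coefficient is k + 1.\<close>

lemma carlitz_1_unique:
  fixes b c :: "nat \<Rightarrow> 'a::field_char_0"
  assumes b: "is_carlitz_bernoulli 1 b" and c: "is_carlitz_bernoulli 1 c"
  shows "b = c"
proof
  fix k show "b k = c k"
  proof (induction k rule: less_induct)
    case (less k)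
    have "(\<Sum>i<k. of_nat (Suc k choose i) * b i) = (\<Sum>i<k. of_nat (Suc k choose i) * c i)"
      using less by (intro sum.cong) auto
    moreover have "(\<Sum>i<Suc k. of_nat (Suc k choose i) * f i) = (if k = 0 then 1 else 0)"
      if "is_carlitz_bernoulli 1 f" for f :: "nat \<Rightarrow> 'a"
      using that is_carlitz_bernoulli_step[of 1 "Suc k" f]
      by (simp add: is_carlitz_bernoulli_def del: sum.lessThan_Suc sum.atMost_Suc)
    from this[OF b] this[OF c]
    have "(\<Sum>i<Suc k. of_nat (Suc k choose i) * b i) = (\<Sum>i<Suc k. of_nat (Suc k choose i) * c i)"
      by (rule trans[OF _ sym])
    ultimately have "of_nat (Suc k) * b k = of_nat (Suc k) * c k" by simp
    thus ?case by (simp del: of_nat_Suc)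
  qed
qed

lemma carlitz_unique:
  assumes b: "is_carlitz_bernoulli q b" and c: "is_carlitz_bernoulli q c"
  shows "b = c"
  using assms carlitz_1_unique is_carlitz_bernoulli_unique carlitz_no_root_of_unity by metis

lemma carlitz_inverse:
  assumes b: "is_carlitz_bernoulli q b" and c: "is_carlitz_bernoulli (1 / q) c"
    and q: "q \<noteq> 0" and n: "n > 1"
  shows "q * c n = (- q) ^ n * b n"
proof -
  \<comment> \<open>Chosen so that 1 + r/q = -qX: the powers in the relations for 1/q then become
    multiples of the moments \<open>b k\<close>.\<close>
  define r where "r = [:- q, - q\<^sup>2:]"
  define c' where "c' = (\<lambda>n. umbral b (r ^ n))"
  have r: "r = smult (- q) [:1, q:]" by (simp add: r_def power2_eq_square)
  have c'_eq: "c' k = (- q) ^ k * umbral b ([:1, q:] ^ k)" for k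
    by (simp only: c'_def r smult_power umbral_smult)
  have rel: "q * umbral b ([:1, q:] ^ k) - b k = (if k = 1 then 1 else 0)" if "k \<ge> 1" for k
    using b that by (simp add: is_carlitz_bernoulli_iff_umbral)
  have "is_carlitz_bernoulli (1 / q) c'"
    unfolding is_carlitz_bernoulli_iff_umbral
  proof (intro conjI allI impI)
    show "c' 0 = 1"
      using b by (simp add: c'_def umbral_def is_carlitz_bernoulli_def)
    fix k :: nat assume k: "k \<ge> 1"
    have lin: "pcompose [:1, 1 / q:] r = smult (- q) [:0, 1:]"
      using q by (simp add: r_def pcompose_pCons power2_eq_square)
    have "umbral c' ([:1, 1 / q:] ^ k) = umbral b (pcompose ([:1, 1 / q:] ^ k) r)"
      by (rule umbral_pcompose[symmetric]) (simp add: c'_def)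
    also have "\<dots> = (- q) ^ k * b k"
      by (simp only: pcompose_power lin smult_power umbral_smult umbral_X_power)
    finally have "1 / q * umbral c' ([:1, 1 / q:] ^ k) - c' k =
        - ((- q) ^ k / q * (q * umbral b ([:1, q:] ^ k) - b k))"
      using q by (simp add: c'_eq field_simps)
    \<comment> \<open>The factor -(-q)^k/q is 1 at k = 1; for k > 1 the bracket vanishes.\<close>
    also have "\<dots> = (if k = 1 then 1 else 0)"
      using q unfolding rel[OF k] by simp
    finally show "1 / q * umbral c' ([:1, 1 / q:] ^ k) - c' k = (if k = 1 then 1 else 0)" .
  qed
  hence "c = c'" using c carlitz_unique by blast
  thus ?thesis using rel[of n] n by (simp add: c'_eq)
qed

text \<open>X -> qX + 1 turns 1 - X into -qX, so the functional equation for (1 - X)^n involves only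
  \<open>b n\<close>, which \<open>carlitz_inverse\<close> converts to \<open>c n\<close>. The rest
  comes from the coefficients 1 and -n.\<close>

lemma carlitz_reflection:
  assumes b: "is_carlitz_bernoulli q b" and c: "is_carlitz_bernoulli (1 / q) c"
    and q: "q \<noteq> 0" and n: "n > 1"
  shows "umbral b ([:1, - 1:] ^ n) = of_nat n + 1 - q + q\<^sup>2 * c n"
proof -
  have lin: "pcompose [:1, - 1:] [:1, q:] = smult (- q) [:0, 1:]"
    by (simp add: pcompose_pCons)
  have "umbral b (pcompose ([:1, - 1:] ^ n) [:1, q:]) = (- q) ^ n * b n"
    by (simp only: pcompose_power lin smult_power umbral_smult umbral_X_power)
  also have "\<dots> = q * c n" using carlitz_inverse[OF assms] by simp
  finally show ?thesis
    using carlitz_functional_equation[OF b, of "[:1, - 1:] ^ n"]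
    by (simp add: coeff_0_power coeff_linear_power_1 power2_eq_square algebra_simps del: One_nat_def)
qed

lemma carlitz_binomial_identity:
  assumes b: "is_carlitz_bernoulli q b" and c: "is_carlitz_bernoulli (1 / q) c"
    and q: "q \<noteq> 0" and N: "N > K + 1"
  shows "(\<Sum>l=0..K. of_nat (K choose l) * (- 1) ^ (K - l) *
            ((of_nat N - of_nat l + 1) - q + q\<^sup>2 * c (N - l))) =
         (\<Sum>l=0..N - K. of_nat ((N - K) choose l) * (- 1) ^ l * b (K + l))"
proof -
  define X Y where "X = ([:0, 1:] :: 'a poly)" and "Y = ([:1, - 1:] :: 'a poly)"
  have XY: "X = - Y + 1" by (simp add: X_def Y_def one_pCons)
  have "X ^ K = (\<Sum>l\<le>K. of_nat (K choose l) * 1 ^ l * (- Y) ^ (K - l))"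
    unfolding XY by (subst add.commute) (rule binomial_ring)
  hence "X ^ K * Y ^ (N - K) =
      (\<Sum>l\<le>K. of_nat (K choose l) * (- 1) ^ (K - l) * (Y ^ (K - l) * Y ^ (N - K)))"
    by (simp add: sum_distrib_right power_minus[of Y] mult.assoc)
  also have "\<dots> = (\<Sum>l\<le>K. smult (of_nat (K choose l) * (- 1) ^ (K - l)) (Y ^ (N - l)))"
  proof (intro sum.cong refl)
    fix l assume "l \<in> {..K}"
    hence "(K - l) + (N - K) = N - l" using N by auto
    thus "of_nat (K choose l) * (- 1) ^ (K - l) * (Y ^ (K - l) * Y ^ (N - K)) =
        smult (of_nat (K choose l) * (- 1) ^ (K - l)) (Y ^ (N - l))"
      by (cases "even (K - l)") (simp_all add: of_nat_poly flip: power_add)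
  qed
  finally have "umbral b (X ^ K * Y ^ (N - K)) =
      (\<Sum>l\<le>K. of_nat (K choose l) * (- 1) ^ (K - l) * umbral b (Y ^ (N - l)))"
    by (simp add: umbral_sum umbral_smult)
  also have "\<dots> = (\<Sum>l\<le>K. of_nat (K choose l) * (- 1) ^ (K - l) *
            ((of_nat N - of_nat l + 1) - q + q\<^sup>2 * c (N - l)))"
    \<comment> \<open>\<open>N > K + 1\<close> keeps each exponent \<open>N - l\<close> with l \<le>
      K above 1, as the reflection formula requires.\<close>
    using N unfolding Y_def
    by (intro sum.cong refl) (simp add: carlitz_reflection[OF b c q] of_nat_diff)
  finally have left: "umbral b (X ^ K * Y ^ (N - K)) = \<dots>" .
  \<comment> \<open>Now \<open>X ^ K\<close> is kept and the other factor is expanded in powers of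
    X.\<close>
  have "X ^ K * Y ^ (N - K) =
      (\<Sum>l\<le>N - K. smult (of_nat ((N - K) choose l) * (- 1) ^ l) (X ^ (K + l)))"
    unfolding Y_def linear_power_eq_sum[of 1 "- 1"] X_def[symmetric]
    by (simp add: sum_distrib_left power_add)
  hence "umbral b (X ^ K * Y ^ (N - K)) =
      (\<Sum>l\<le>N - K. of_nat ((N - K) choose l) * (- 1) ^ l * b (K + l))"
    by (simp only: umbral_sum umbral_smult X_def umbral_X_power)
  with left show ?thesis by (simp add: atLeast0AtMost)
qed

theorem theorem6:
  fixes absv :: "'a::field_char_0 \<Rightarrow> real" and p :: nat
    and q :: 'a and \<beta> :: "'a \<Rightarrow> nat \<Rightarrow> 'a"
    and s k :: nat and m n :: "nat \<Rightarrow> nat"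
  assumes "padic_complex_field p absv"
    and "absv (1 - q) < 1"
    and "is_carlitz_bernoulli q (\<beta> q)"
    and "is_carlitz_bernoulli (1 / q) (\<beta> (1 / q))"
    and "s \<ge> 1"
    and "(\<Sum>i=1..s. m i * n i) > (\<Sum>i=1..s. m i) * k + 1"
  shows "(\<Sum>l=0..k * (\<Sum>i=1..s. m i).
            of_nat ((k * (\<Sum>i=1..s. m i)) choose l) * (- 1) ^ (k * (\<Sum>i=1..s. m i) - l) *
            ((of_nat (\<Sum>i=1..s. m i * n i) - of_nat l + 1) - q
             + q\<^sup>2 * \<beta> (1 / q) ((\<Sum>i=1..s. n i * m i) - l)))
       = (\<Sum>l=0..(\<Sum>i=1..s. n i * m i) - k * (\<Sum>i=1..s. m i).
            of_nat (((\<Sum>i=1..s. n i * m i) - k * (\<Sum>i=1..s. m i)) choose l) * (- 1) ^ l *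
            \<beta> q ((\<Sum>i=1..s. m i) * k + l))"
proof -
  interpret padic_complex_field p absv by fact
  \<comment> \<open>At q = 0 the absolute value of 1 - q would be 1.\<close>
  have q: "q \<noteq> 0" using assms(2) absv_1 by auto
  have N: "(\<Sum>i=1..s. n i * m i) = (\<Sum>i=1..s. m i * n i)" by (simp only: mult.commute)
  have K: "(\<Sum>i=1..s. m i) * k = k * (\<Sum>i=1..s. m i)" by (rule mult.commute)
  show ?thesis
    using carlitz_binomial_identity[OF assms(3,4) q assms(6)] unfolding N K .
qed

end
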